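(* (Assuming the axiom of choice.) There is a continuous free action of $\Gamma=(\mathbb{Z}/2\mathbb{Z})^{*3}$ (hence a paradoxical action) on a Polish space $X$ such that there is a finitely additive $\Gamma$-invariant Borel probability measure on $X$, but there is no countably additive $\Gamma$-invariant Borel probability measure on $X$.
   Context: $(\mathbb{Z}/2\mathbb{Z})^{*3}=\langle a,b,c : a^2=b^2=c^2=1\rangle$ is the free product of three copies of $\mathbb{Z}/2\mathbb{Z}$. An action is free if $\gamma\cdot x\neq x$ for all $x$ and all $\gamma\neq1$. A finitely additive Borel probability measure on $X$ is a finitely additive function $\mu\colon\mathcal{B}(X)\to[0,1]$ on the Borel sets with $\mu(X)=1$; it is $\Gamma$-invariant if $\mu(\gamma A)=\mu(A)$ for all Borel $A$ and $\gamma\in\Gamma$. *)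

theory Defs
  imports "HOL-Probability.Probability" "HOL-Algebra.Group_Action"
begin

section \<open>The group \<open>(\<int>/2\<int>)\<^sup>*\<^sup>3 = \<langle>a, b, c : a\<^sup>2 = b\<^sup>2 = c\<^sup>2 = 1\<rangle>\<close>\<close>

datatype gen = Gen_a | Gen_b | Gen_c

text \<open>
  The relations make every generator its own inverse, so the group is the set of words in the
  three generators (no formal inverses needed) modulo the congruence generated by \<open>s s \<sim> 1\<close>.
\<close>

inductive word_eq :: "gen list \<Rightarrow> gen list \<Rightarrow> bool" where
  word_eq_refl: "word_eq u u"
| word_eq_sym: "word_eq u v \<Longrightarrow> word_eq v u"
| word_eq_trans: "word_eq u v \<Longrightarrow> word_eq v w \<Longrightarrow> word_eq u w"
| word_eq_square: "word_eq (u @ [s, s] @ v) (u @ v)"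

definition word_class :: "gen list \<Rightarrow> gen list set" where
  "word_class u = {v. word_eq u v}"

definition Z2_free3 :: "gen list set monoid" where
  "Z2_free3 = \<lparr>carrier = range word_class,
            mult = (\<lambda>P Q. \<Union>u\<in>P. \<Union>v\<in>Q. word_class (u @ v)),
            one = word_class []\<rparr>"

lemma word_class_eq_iff: "word_class u = word_class v \<longleftrightarrow> word_eq u v"
  unfolding word_class_def set_eq_iff mem_Collect_eq
  by (meson word_eq_refl word_eq_sym word_eq_trans)

lemma word_eq_append_left: "word_eq u v \<Longrightarrow> word_eq (w @ u) (w @ v)"
proof (induction rule: word_eq.induct)
  case (word_eq_refl u)
  show ?case by (rule word_eq.word_eq_refl)
next
  case (word_eq_sym u v)
  show ?case using word_eq_sym.IH by (rule word_eq.word_eq_sym)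
next
  case (word_eq_trans u v w')
  show ?case using word_eq_trans.IH by (rule word_eq.word_eq_trans)
next
  case (word_eq_square u s v)
  show ?case using word_eq.word_eq_square[of "w @ u" s v] by simp
qed

lemma word_eq_append_right: "word_eq u v \<Longrightarrow> word_eq (u @ w) (v @ w)"
proof (induction rule: word_eq.induct)
  case (word_eq_refl u)
  show ?case by (rule word_eq.word_eq_refl)
next
  case (word_eq_sym u v)
  show ?case using word_eq_sym.IH by (rule word_eq.word_eq_sym)
next
  case (word_eq_trans u v w')
  show ?case using word_eq_trans.IH by (rule word_eq.word_eq_trans)
next
  case (word_eq_square u s v)
  show ?case using word_eq.word_eq_square[of u s "v @ w"] by simp
qed

lemma mult_Z2_free3: "word_class u \<otimes>\<^bsub>Z2_free3\<^esub> word_class v = word_class (u @ v)"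
proof -
  have eq: "word_class (u' @ v') = word_class (u @ v)"
    if "u' \<in> word_class u" "v' \<in> word_class v" for u' v'
  proof -
    have "word_eq u u'" "word_eq v v'"
      using that by (simp_all add: word_class_def)
    then have "word_eq (u @ v) (u' @ v')"
      by (blast intro: word_eq_trans[OF word_eq_append_right word_eq_append_left])
    then show ?thesis
      unfolding word_class_eq_iff by (rule word_eq_sym)
  qed
  have "u \<in> word_class u" "v \<in> word_class v"
    by (simp_all add: word_class_def word_eq_refl)
  then have "(\<Union>u'\<in>word_class u. \<Union>v'\<in>word_class v. word_class (u' @ v')) = word_class (u @ v)"
    by (metis (no_types, lifting) UN_constant eq SUP_cong empty_iff)
  then show ?thesis
    by (simp only: Z2_free3_def monoid.simps)
qed

lemma word_eq_rev_append: "word_eq (rev u @ u) []"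
proof (induction u)
  case (Cons s u)
  have "word_eq (rev (s # u) @ s # u) (rev u @ u)"
    using word_eq_square[of "rev u" s u] by simp
  from word_eq_trans[OF this Cons] show ?case .
qed (simp add: word_eq_refl)

lemma group_Z2_free3: "group Z2_free3"
proof (rule groupI)
  fix x assume "x \<in> carrier Z2_free3"
  then obtain u where "x = word_class u" by (auto simp: Z2_free3_def)
  then have "word_class (rev u) \<otimes>\<^bsub>Z2_free3\<^esub> x = word_class []"
    by (simp only: mult_Z2_free3 word_class_eq_iff word_eq_rev_append)
  then show "\<exists>y\<in>carrier Z2_free3. y \<otimes>\<^bsub>Z2_free3\<^esub> x = \<one>\<^bsub>Z2_free3\<^esub>"
    by (intro bexI[of _ "word_class (rev u)"]) (simp_all add: Z2_free3_def)
next
  have carr: "carrier Z2_free3 = range word_class" and one: "\<one>\<^bsub>Z2_free3\<^esub> = word_class []"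
    by (auto simp: Z2_free3_def)
  show "\<one>\<^bsub>Z2_free3\<^esub> \<in> carrier Z2_free3"
    by (simp add: carr one)
  show "x \<otimes>\<^bsub>Z2_free3\<^esub> y \<in> carrier Z2_free3"
    if "x \<in> carrier Z2_free3" "y \<in> carrier Z2_free3" for x y
    using that by (auto simp: carr mult_Z2_free3)
  show "x \<otimes>\<^bsub>Z2_free3\<^esub> y \<otimes>\<^bsub>Z2_free3\<^esub> z = x \<otimes>\<^bsub>Z2_free3\<^esub> (y \<otimes>\<^bsub>Z2_free3\<^esub> z)"
    if "x \<in> carrier Z2_free3" "y \<in> carrier Z2_free3" "z \<in> carrier Z2_free3" for x y z
    using that by (auto simp: carr mult_Z2_free3)
  show "\<one>\<^bsub>Z2_free3\<^esub> \<otimes>\<^bsub>Z2_free3\<^esub> x = x" if "x \<in> carrier Z2_free3" for x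
    using that by (auto simp: carr one mult_Z2_free3)
qed


section \<open>Actions\<close>

text \<open>
  Below, \<open>\<phi> g x\<close> is \<open>g \<cdot> x\<close>; that \<open>\<phi>\<close> is an action of \<open>G\<close> on the set \<open>E\<close> is
  \<^const>\<open>group_action\<close> and is required separately.
\<close>

definition free_action :: "('g, 'm) monoid_scheme \<Rightarrow> 'a set \<Rightarrow> ('g \<Rightarrow> 'a \<Rightarrow> 'a) \<Rightarrow> bool" where
  "free_action G E \<phi> \<longleftrightarrow> (\<forall>g\<in>carrier G. \<forall>x\<in>E. g \<noteq> \<one>\<^bsub>G\<^esub> \<longrightarrow> \<phi> g x \<noteq> x)"

text \<open>Joint continuity of \<open>G \<times> X \<rightarrow> X\<close>, where \<open>G\<close> is a discrete group.\<close>

definition continuous_action ::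
    "('g, 'm) monoid_scheme \<Rightarrow> 'a topology \<Rightarrow> ('g \<Rightarrow> 'a \<Rightarrow> 'a) \<Rightarrow> bool" where
  "continuous_action G X \<phi> \<longleftrightarrow>
     continuous_map (prod_topology (discrete_topology (carrier G)) X) X (\<lambda>(g, x). \<phi> g x)"

text \<open>
  \<open>E\<close> has a finite partition \<open>A\<^sub>0, \<dots>, A\<^sub>m\<^sub>-\<^sub>1, B\<^sub>0, \<dots>, B\<^sub>n\<^sub>-\<^sub>1\<close> such that suitable translates
  of the \<open>A\<^sub>i\<close> partition \<open>E\<close>, and so do suitable translates of the \<open>B\<^sub>j\<close>.
  The pieces are arbitrary subsets of \<open>E\<close>.
\<close>

definition paradoxical_action ::
    "('g, 'm) monoid_scheme \<Rightarrow> 'a set \<Rightarrow> ('g \<Rightarrow> 'a \<Rightarrow> 'a) \<Rightarrow> bool" where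
  "paradoxical_action G E \<phi> \<longleftrightarrow>
     (\<exists>(m::nat) (n::nat) A B \<alpha> \<beta>.
        (\<forall>i<m. \<alpha> i \<in> carrier G) \<and> (\<forall>j<n. \<beta> j \<in> carrier G) \<and>
        disjoint_family_on A {..<m} \<and> disjoint_family_on B {..<n} \<and>
        (\<Union>i<m. A i) \<inter> (\<Union>j<n. B j) = {} \<and>
        (\<Union>i<m. A i) \<union> (\<Union>j<n. B j) = E \<and>
        disjoint_family_on (\<lambda>i. \<phi> (\<alpha> i) ` A i) {..<m} \<and> (\<Union>i<m. \<phi> (\<alpha> i) ` A i) = E \<and>
        disjoint_family_on (\<lambda>j. \<phi> (\<beta> j) ` B j) {..<n} \<and> (\<Union>j<n. \<phi> (\<beta> j) ` B j) = E)"


section \<open>Polish spaces and invariant Borel measures\<close>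

text \<open>
  Every Polish space has at most the cardinality of the continuum, hence has a homeomorphic copy on
  a subset of \<open>nat \<Rightarrow> nat\<close>. So \<open>\<exists>X :: (nat \<Rightarrow> nat) topology. polish_topology X \<and> \<dots>\<close>, with an
  arbitrary topology unrelated to the product topology of the type, ranges over all Polish spaces.
\<close>

definition polish_topology :: "'a topology \<Rightarrow> bool" where
  "polish_topology X \<longleftrightarrow> separable_space X \<and> completely_metrizable_space X"

definition borel_sets :: "'a topology \<Rightarrow> 'a set set" where
  "borel_sets X = sigma_sets (topspace X) {U. openin X U}"

definition finitely_additive_borel_prob :: "'a topology \<Rightarrow> ('a set \<Rightarrow> real) \<Rightarrow> bool" where
  "finitely_additive_borel_prob X \<mu> \<longleftrightarrow>
     (\<forall>A\<in>borel_sets X. 0 \<le> \<mu> A \<and> \<mu> A \<le> 1) \<and>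
     additive (borel_sets X) \<mu> \<and>
     \<mu> (topspace X) = 1"

definition countably_additive_borel_prob :: "'a topology \<Rightarrow> 'a measure \<Rightarrow> bool" where
  "countably_additive_borel_prob X M \<longleftrightarrow>
     space M = topspace X \<and> sets M = borel_sets X \<and> prob_space M"

definition invariant_set_function ::
    "('g, 'm) monoid_scheme \<Rightarrow> ('g \<Rightarrow> 'a \<Rightarrow> 'a) \<Rightarrow> 'a set set \<Rightarrow> ('a set \<Rightarrow> 'b) \<Rightarrow> bool" where
  "invariant_set_function G \<phi> \<B> \<mu> \<longleftrightarrow> (\<forall>g\<in>carrier G. \<forall>A\<in>\<B>. \<mu> (\<phi> g ` A) = \<mu> A)"

end

theory Submission
  imports Defs "HOL-Combinatorics.Permutations"
begin

text \<open>
  The group \<open>\<Gamma>\<close> maps onto the infinite dihedral group by \<open>c \<mapsto> 1\<close>, which acts transitively on \<open>\<nat>\<close>: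
  the generators \<open>a\<close> and \<open>b\<close> swap the endpoints of alternate edges of the ray \<open>0, 1, 2, \<dots>\<close>. This action
  has an invariant mean (a limit of averages over initial segments) but no invariant countably
  additive probability. Since \<open>\<Gamma>\<close> is
  residually finite, it also acts freely on a product of finite groups and preserves the product of
  the uniform measures. The diagonal action on the product of the two spaces is free, an invariant
  mean is obtained by integrating the product measure against the mean on \<open>\<nat>\<close>, and an invariant
  countably additive measure would project to one on \<open>\<nat>\<close>. The space is realised as all of
  \<^typ>\<open>nat \<Rightarrow> nat\<close>: coordinate \<open>0\<close> carries the ray, and each later coordinate carries countably many
  copies of a finite group, only one of which is charged by the measure.
\<close>

section \<open>Reduced words\<close>

text \<open>Left multiplication by a generator, seen on reduced words. It fixes non-reduced lists,
  which makes it an involution on the whole type.\<close>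

definition push :: "gen \<Rightarrow> gen list \<Rightarrow> gen list" where
  "push s w = (if distinct_adj w then if w \<noteq> [] \<and> hd w = s then tl w else s # w else w)"

lemma distinct_adj_push: "distinct_adj w \<Longrightarrow> distinct_adj (push s w)"
  by (cases w) (auto simp: push_def distinct_adj_Cons)

lemma push_push [simp]: "push s (push s w) = w"
  by (cases w) (auto simp: push_def distinct_adj_Cons)

lemma push_Cons: "distinct_adj (s # w) \<Longrightarrow> push s w = s # w"
  by (cases w) (auto simp: push_def)

definition nf :: "gen list \<Rightarrow> gen list" where
  "nf w = foldr push w []"

lemma nf_Nil [simp]: "nf [] = []"
  by (simp add: nf_def)

lemma nf_Cons: "nf (s # w) = push s (nf w)"
  by (simp add: nf_def)

lemma distinct_adj_nf: "distinct_adj (nf w)"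
  by (induction w) (simp_all add: nf_Cons distinct_adj_push)

lemma word_eq_push: "distinct_adj w \<Longrightarrow> word_eq (s # w) (push s w)"
  using word_eq_square[of "[]" s "tl w"] by (cases w) (auto simp: push_def word_eq_refl)

lemma word_eq_nf: "word_eq w (nf w)"
proof (induction w)
  case (Cons s w)
  have "word_eq (s # w) (s # nf w)"
    using word_eq_append_left[OF Cons, of "[s]"] by simp
  then show ?case
    unfolding nf_Cons using word_eq_push[OF distinct_adj_nf] by (rule word_eq_trans)
qed (simp add: word_eq_refl)

section \<open>Actions given by three involutions\<close>

locale involutions =
  fixes \<sigma> :: "gen \<Rightarrow> 'a \<Rightarrow> 'a"
  assumes invol [simp]: "\<sigma> s (\<sigma> s x) = x"
begin

lemma foldr_word_eq: "word_eq u v \<Longrightarrow> foldr \<sigma> u = foldr \<sigma> v"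
  by (induction rule: word_eq.induct) (auto simp: fun_eq_iff)

text \<open>The choice of representative is harmless: squares act trivially, so by
  \<open>foldr_word_eq\<close> all words of a class act alike.\<close>

definition act :: "gen list set \<Rightarrow> 'a \<Rightarrow> 'a" where
  "act g = foldr \<sigma> (SOME w. g = word_class w)"

lemma act_word_class: "act (word_class w) = foldr \<sigma> w"
proof -
  have "word_class w = word_class (SOME v. word_class w = word_class v)"
    by (rule someI) (rule refl)
  then show ?thesis
    unfolding act_def word_class_eq_iff by (metis foldr_word_eq)
qed

lemma foldr_rev: "foldr \<sigma> (rev w) (foldr \<sigma> w x) = x" "foldr \<sigma> w (foldr \<sigma> (rev w) x) = x"
  using foldr_word_eq[OF word_eq_rev_append, of w] foldr_word_eq[OF word_eq_rev_append, of "rev w"]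
  by (simp_all add: fun_eq_iff)

lemma bij_foldr: "bij (foldr \<sigma> w)"
  by (rule bij_betw_byWitness[where f' = "foldr \<sigma> (rev w)"]) (auto simp: foldr_rev)

lemma image_foldr: "foldr \<sigma> w ` A = {x. foldr \<sigma> (rev w) x \<in> A}"
  by (auto simp: foldr_rev image_iff) (metis foldr_rev(2))

lemma image_invol: "\<sigma> s ` A = \<sigma> s -` A"
  using image_foldr[of "[s]" A] by auto

lemma group_action_act: "group_action Z2_free3 UNIV act"
  unfolding group_action_def group_hom_def group_hom_axioms_def
proof (intro conjI group_Z2_free3 group_BijGroup homI)
  show "act g \<in> carrier (BijGroup UNIV)" if "g \<in> carrier Z2_free3" for g
    using that bij_foldr by (auto simp: Z2_free3_def BijGroup_def Bij_def act_word_class)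
  show "act (g \<otimes>\<^bsub>Z2_free3\<^esub> h) = act g \<otimes>\<^bsub>BijGroup UNIV\<^esub> act h"
    if "g \<in> carrier Z2_free3" "h \<in> carrier Z2_free3" for g h
  proof -
    obtain u where "g = word_class u"
      using \<open>g \<in> carrier Z2_free3\<close> by (auto simp: Z2_free3_def)
    moreover obtain v where "h = word_class v"
      using \<open>h \<in> carrier Z2_free3\<close> by (auto simp: Z2_free3_def)
    ultimately show ?thesis
      using bij_foldr
      by (auto simp: mult_Z2_free3 act_word_class BijGroup_def Bij_def compose_def fun_eq_iff)
  qed
qed

end

interpretation push: involutions push
  by unfold_locales simp

locale free_involutions = involutions +
  assumes free: "distinct_adj w \<Longrightarrow> w \<noteq> [] \<Longrightarrow> foldr \<sigma> w x \<noteq> x"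
begin

text \<open>The reduced form of \<open>rev v @ u\<close> fixes \<open>x\<close>, so by freeness it
  is empty.\<close>

lemma word_eq_if_foldr_eq:
  assumes "foldr \<sigma> u x = foldr \<sigma> v x"
  shows "word_eq u v"
proof -
  have "foldr \<sigma> (nf (rev v @ u)) x = foldr \<sigma> (rev v @ u) x"
    using foldr_word_eq[OF word_eq_nf, of "rev v @ u"] by simp
  also have "\<dots> = x"
    using assms by (simp add: foldr_rev)
  finally have "nf (rev v @ u) = []"
    using free distinct_adj_nf by blast
  then have "word_eq (rev v @ u) []"
    using word_eq_nf by metis
  then have "word_eq (v @ rev v @ u) v"
    using word_eq_append_left[of "rev v @ u" "[]" v] by simp
  moreover have "word_eq (v @ rev v @ u) u"
    using word_eq_append_right[OF word_eq_rev_append[of "rev v"], of u] by simp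
  ultimately show ?thesis
    by (meson word_eq_sym word_eq_trans)
qed

lemma free_action_act: "free_action Z2_free3 UNIV act"
  unfolding free_action_def
proof (intro ballI impI)
  fix g and x :: 'a
  assume g: "g \<in> carrier Z2_free3" "g \<noteq> \<one>\<^bsub>Z2_free3\<^esub>"
  then obtain w where w: "g = word_class w"
    by (auto simp: Z2_free3_def)
  then have "\<not> word_eq w []"
    using g(2) by (simp add: Z2_free3_def word_class_eq_iff)
  then show "act g x \<noteq> x"
    using word_eq_if_foldr_eq[of w x "[]"] by (auto simp: w act_word_class)
qed

text \<open>A base point chosen in each orbit identifies that orbit with the set of reduced words.\<close>

lemma ex_equivariant_reduced_word:
  obtains f :: "'a \<Rightarrow> gen list"
  where "\<And>x. distinct_adj (f x)" "\<And>s x. f (\<sigma> s x) = push s (f x)"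
proof -
  define orb where "orb x = range (\<lambda>w. foldr \<sigma> w x)" for x
  have "foldr \<sigma> w (\<sigma> s x) = foldr \<sigma> (w @ [s]) x" for w s x
    by simp
  then have "orb (\<sigma> s x) \<subseteq> orb x" for s x
    unfolding orb_def by blast
  from this this[of s "\<sigma> s x" for s x] have orb: "orb (\<sigma> s x) = orb x" for s x
    by (metis invol subset_antisym)
  define b where "b x = (SOME y. y \<in> orb x)" for x
  have b: "b (\<sigma> s x) = b x" for s x
    by (simp add: b_def orb)
  have "b x \<in> orb x" for x
    unfolding b_def by (rule someI[of _ x]) (auto simp: orb_def intro!: range_eqI[of _ _ "[]"])
  then have "\<exists>w. x = foldr \<sigma> w (b x)" for x
    unfolding orb_def by (metis (no_types, lifting) foldr_rev(1) image_iff)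
  then obtain k where k: "x = foldr \<sigma> (k x) (b x)" for x
    by metis
  show ?thesis
  proof (rule that[of "\<lambda>x. nf (k x)"])
    fix s x
    have "foldr \<sigma> (k (\<sigma> s x)) (b x) = foldr \<sigma> (s # k x) (b x)"
      using k[of x] k[of "\<sigma> s x"] by (simp add: b)
    then have "word_eq (k (\<sigma> s x)) (s # k x)"
      by (rule word_eq_if_foldr_eq)
    \<comment> \<open>\<open>push\<close> is itself an action by involutions, so \<open>nf\<close>
      is constant on classes.\<close>
    then have "nf (k (\<sigma> s x)) = nf (s # k x)"
      unfolding nf_def by (metis push.foldr_word_eq)
    then show "nf (k (\<sigma> s x)) = push s (nf (k x))"
      by (simp add: nf_Cons)
  qed (rule distinct_adj_nf)
qed

text \<open>
  With \<open>W u\<close> the set of reduced words that begin with \<open>u\<close>, the translate of \<open>W ba\<close> by \<open>ab\<close> is the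
  complement of \<open>W a\<close>, and the translate of \<open>W bc\<close> by \<open>cb\<close> is the complement of \<open>W c\<close>. These four
  sets miss only the words \<open>1\<close> and \<open>b\<close>; moving the words \<open>1, b, bc, bcb, \<dots>\<close> (the set \<open>D\<close>) from
  \<open>W bc\<close> to \<open>W c\<close> absorbs them.
\<close>

lemma paradoxical_action_act: "paradoxical_action Z2_free3 UNIV act"
proof -
  obtain f :: "'a \<Rightarrow> gen list"
    where f: "\<And>x. distinct_adj (f x)" "\<And>s x. f (\<sigma> s x) = push s (f x)"
    using ex_equivariant_reduced_word by blast
  define W where "W u = {w :: gen list. \<exists>v. w = u @ v}" for u
  define D where "D = {w. set w \<subseteq> {Gen_b, Gen_c} \<and> (w \<noteq> [] \<longrightarrow> hd w = Gen_b)}"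
  define A where "A i = f -` (if i = 0 then W [Gen_a] else W [Gen_b, Gen_a])" for i :: nat
  define B where "B i = f -` (if i = 0 then W [Gen_c] \<union> D else W [Gen_b, Gen_c] - D)" for i :: nat
  define \<alpha> where "\<alpha> i = word_class (if i = 0 then [] else [Gen_a, Gen_b])" for i :: nat
  define \<beta> where "\<beta> i = word_class (if i = 0 then [] else [Gen_c, Gen_b])" for i :: nat
  have lessThan2: "{..<2::nat} = {0, 1}"
    by auto
  have gen: "s = Gen_a \<or> s = Gen_b \<or> s = Gen_c" for s
    by (cases s) auto
  \<comment> \<open>By \<open>image_foldr\<close>, membership in the translate by \<open>ab\<close>
    is tested by applying the inverse \<open>ba\<close>.\<close>
  have ab: "push Gen_b (push Gen_a w) \<in> W [Gen_b, Gen_a] \<longleftrightarrow> w \<notin> W [Gen_a]" if "distinct_adj w" for w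
    using that
    apply (cases w; cases "tl w")
    using gen[of "hd w"] gen[of "hd (tl w)"] apply (auto simp: W_def push_def distinct_adj_Cons)
    done
  \<comment> \<open>Multiplying by \<open>bc\<close> sends a reduced word not starting with
    \<open>c\<close> into \<open>W [Gen_b, Gen_c]\<close>, and the result lies in \<open>D\<close>
    exactly when the word does.\<close>
  have cb: "push Gen_b (push Gen_c w) \<in> W [Gen_b, Gen_c] - D \<longleftrightarrow> w \<notin> W [Gen_c] \<union> D"
    if "distinct_adj w" for w
    using that
    apply (cases w; cases "tl w")
    using gen[of "hd w"] gen[of "hd (tl w)"] apply (auto simp: W_def D_def push_def distinct_adj_Cons)
    done
  have part: "W [Gen_a] \<inter> W [Gen_b, Gen_a] = {}" "(W [Gen_c] \<union> D) \<inter> (W [Gen_b, Gen_c] - D) = {}"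
    "(W [Gen_a] \<union> W [Gen_b, Gen_a]) \<inter> ((W [Gen_c] \<union> D) \<union> (W [Gen_b, Gen_c] - D)) = {}"
    by (auto simp: W_def D_def)
  have cover: "w \<in> W [Gen_a] \<union> W [Gen_b, Gen_a] \<union> (W [Gen_c] \<union> D \<union> (W [Gen_b, Gen_c] - D))"
    if "distinct_adj w" for w
    using that
    apply (cases w; cases "tl w")
    using gen[of "hd w"] gen[of "hd (tl w)"] apply (auto simp: W_def D_def)
    done
  have img: "act (\<alpha> 0) ` A 0 = A 0" "act (\<beta> 0) ` B 0 = B 0"
    "act (\<alpha> (Suc 0)) ` A (Suc 0) = - A 0" "act (\<beta> (Suc 0)) ` B (Suc 0) = - B 0"
    unfolding \<alpha>_def \<beta>_def act_word_class image_foldr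
    using ab[OF f(1)] cb[OF f(1)] by (auto simp: A_def B_def f(2))
  show ?thesis
    unfolding paradoxical_action_def
  proof (rule exI[of _ 2], rule exI[of _ 2], rule exI[of _ A], rule exI[of _ B],
      rule exI[of _ \<alpha>], rule exI[of _ \<beta>], intro conjI)
    show "\<forall>i<2. \<alpha> i \<in> carrier Z2_free3" "\<forall>j<2. \<beta> j \<in> carrier Z2_free3"
      by (auto simp: \<alpha>_def \<beta>_def Z2_free3_def)
    show "disjoint_family_on A {..<2}" "disjoint_family_on B {..<2}"
      using part(1,2) by (auto simp: lessThan2 disjoint_family_on_def A_def B_def)
    show "(\<Union>i<2. A i) \<inter> (\<Union>j<2. B j) = {}"
      using part(3) by (auto simp: lessThan2 A_def B_def)
    show "(\<Union>i<2. A i) \<union> (\<Union>j<2. B j) = UNIV"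
    proof (intro UNIV_eq_I[symmetric])
      show "x \<in> (\<Union>i<2. A i) \<union> (\<Union>j<2. B j)" for x
        using cover[OF f(1), of x] by (auto simp: lessThan2 A_def B_def)
    qed
  qed (auto simp: lessThan2 disjoint_family_on_def img)
qed

end

section \<open>Finite quotients\<close>

text \<open>A step that would leave the ball of radius \<open>n\<close> in the Cayley graph becomes
  a loop, so each generator permutes a finite set of words.\<close>

definition trunc_push :: "nat \<Rightarrow> gen \<Rightarrow> gen list \<Rightarrow> gen list" where
  "trunc_push n s w = (if length w \<le> n \<and> length (push s w) \<le> n then push s w else w)"

interpretation trunc_push: involutions "trunc_push n"
  by unfold_locales (auto simp: trunc_push_def)

text \<open>Building \<open>w\<close> letter by letter from \<open>[]\<close> never exceeds length
  \<open>n\<close>, so truncation never intervenes. Short nonempty reduced words therefore act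
  nontrivially.\<close>

lemma foldr_trunc_push: "distinct_adj w \<Longrightarrow> length w \<le> n \<Longrightarrow> foldr (trunc_push n) w [] = w"
  by (induction w) (auto simp: trunc_push_def push_Cons distinct_adj_Cons)

lemma trunc_push_permutes: "trunc_push n s permutes {w. length w \<le> n}"
  unfolding permutes_def
proof (intro conjI allI impI)
  show "\<exists>!v. trunc_push n s v = w" for w
    by (metis trunc_push.invol)
qed (auto simp: trunc_push_def)

lemma finite_words: "finite {w :: gen list. length w \<le> n}"
proof -
  have "(UNIV :: gen set) = {Gen_a, Gen_b, Gen_c}"
    using gen.exhaust by auto
  then have "finite (UNIV :: gen set)"
    by (metis finite.emptyI finite.insertI)
  then show ?thesis
    using finite_lists_length_le[of UNIV n] by simp
qed

text \<open>
  A faithful finite permutation group acts freely on itself by multiplication; countably many copies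
  of this action make up an action on all of \<^typ>\<open>nat\<close>.
\<close>

lemma ex_finite_quotient:
  "\<exists>\<kappa> F. involutions \<kappa> \<and> finite F \<and> F \<noteq> {} \<and> (\<forall>s. \<kappa> s ` F \<subseteq> F) \<and>
     (\<forall>w. distinct_adj w \<longrightarrow> w \<noteq> [] \<longrightarrow> length w \<le> n \<longrightarrow> (\<forall>i::nat. foldr \<kappa> w i \<noteq> i))"
proof -
  define S where "S = {p. p permutes {w :: gen list. length w \<le> n}}"
  \<comment> \<open>Infinitely many copies make \<open>P\<close> countably infinite, hence codable
    by all of \<open>nat\<close>; \<open>F\<close> below is the copy with index 0.\<close>
  define P where "P = S \<times> (UNIV :: nat set)"
  have "finite S"
    unfolding S_def by (rule finite_permutations[OF finite_words])
  have "id \<in> S"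
    by (simp add: S_def permutes_id)
  then have "countable P" "infinite P"
    using \<open>finite S\<close> by (auto simp: P_def countable_finite finite_cartesian_product_iff)
  define d where "d = to_nat_on P"
  define e where "e = from_nat_into P"
  have de: "d (e i) = i" "e i \<in> P" for i
    unfolding d_def e_def using \<open>countable P\<close> \<open>infinite P\<close>
    by (auto simp: to_nat_on_from_nat_into_infinite from_nat_into infinite_imp_nonempty)
  have ed: "e (d q) = q" if "q \<in> P" for q
    unfolding d_def e_def using \<open>countable P\<close> that by simp
  define m where "m s = map_prod (\<lambda>p :: gen list \<Rightarrow> gen list. trunc_push n s \<circ> p) (id :: nat \<Rightarrow> nat)" for s
  have mP: "m s q \<in> P" if "q \<in> P" for s q
    using that by (auto simp: m_def P_def S_def intro: permutes_compose[OF _ trunc_push_permutes])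
  define \<kappa> where "\<kappa> s i = d (m s (e i))" for s i
  define F where "F = d ` (S \<times> {0})"
  have e_\<kappa>: "e (\<kappa> s i) = m s (e i)" for s i
    by (simp add: \<kappa>_def ed mP de)
  have e_foldr: "e (foldr \<kappa> w i) = (foldr (trunc_push n) w \<circ> fst (e i), snd (e i))" for w i
    by (induction w) (simp_all add: e_\<kappa> m_def comp_def)
  have "m s (m s q) = q" for s q
    by (cases q) (simp add: m_def comp_def)
  then have "involutions \<kappa>"
    by unfold_locales (simp add: \<kappa>_def ed mP de)
  moreover have "finite F" "F \<noteq> {}"
    using \<open>finite S\<close> \<open>id \<in> S\<close> by (auto simp: F_def)
  moreover have "\<kappa> s ` F \<subseteq> F" for s
    by (auto simp: F_def \<kappa>_def ed P_def m_def S_def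
        intro!: imageI permutes_compose[OF _ trunc_push_permutes])
  moreover have "foldr \<kappa> w i \<noteq> i" if w: "distinct_adj w" "w \<noteq> []" "length w \<le> n" for w i
  proof
    assume "foldr \<kappa> w i = i"
    then have comp: "foldr (trunc_push n) w \<circ> fst (e i) = fst (e i)"
      using e_foldr[of w i] by (metis fst_conv)
    have "fst (e i) permutes {w. length w \<le> n}"
      using de(2)[of i] by (auto simp: P_def S_def)
    \<comment> \<open>Evaluating at a preimage of \<open>[]\<close> shows that \<open>w\<close>
      would fix \<open>[]\<close>, against \<open>foldr_trunc_push\<close>.\<close>
    then obtain v where "fst (e i) v = []"
      by (metis permutes_def)
    then have "foldr (trunc_push n) w [] = []"
      using fun_cong[OF comp, of v] by simp
    then show False
      using foldr_trunc_push w by simp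
  qed
  ultimately show ?thesis
    by blast
qed

section \<open>Amenable actions\<close>

text \<open>\<open>t\<close> maps \<open>{..<N}\<close> injectively into \<open>{..<Suc N}\<close>,
  so the rearranged sum gains at most one term; the other bound is the same estimate for
  \<open>1 - f\<close>.\<close>

lemma abs_sum_inj_diff_le_1:
  fixes f :: "nat \<Rightarrow> real"
  assumes f: "\<And>i. 0 \<le> f i" "\<And>i. f i \<le> 1" and t: "\<And>i. t (t i) = i" "\<And>i. t i \<le> Suc i"
  shows "\<bar>(\<Sum>i<N. f (t i)) - (\<Sum>i<N. f i)\<bar> \<le> 1"
proof -
  have "(\<Sum>i<N. g (t i)) \<le> (\<Sum>i<N. g i) + 1" if g: "\<And>i. 0 \<le> g i" "\<And>i. g i \<le> 1" for g :: "nat \<Rightarrow> real"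
  proof -
    have "inj_on t {..<N}"
      by (metis inj_onI t(1))
    then have "(\<Sum>i<N. g (t i)) = sum g (t ` {..<N})"
      by (simp add: sum.reindex)
    also have "\<dots> \<le> sum g {..<Suc N}"
      using t(2) by (intro sum_mono2) (auto simp: g intro: le_less_trans[OF t(2)])
    also have "\<dots> \<le> (\<Sum>i<N. g i) + 1"
      using g(2)[of N] by simp
    finally show ?thesis .
  qed
  from this[of f] this[of "\<lambda>i. 1 - f i"] show ?thesis
    using f by (auto simp: sum_subtractf abs_le_iff)
qed

text \<open>The mean is a cluster point of the averages of the first \<open>N\<close> set functions.\<close>

lemma ex_invariant_mean:
  fixes f :: "nat \<Rightarrow> 'a set \<Rightarrow> real" and t :: "'s \<Rightarrow> nat \<Rightarrow> nat"
  assumes f: "\<And>i A. 0 \<le> f i A" "\<And>i A. f i A \<le> 1" "\<And>i. additive \<A> (f i)" "\<And>i. f i \<Omega> = 1"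
    and t: "\<And>s i. t s (t s i) = i" "\<And>s i. t s i \<le> Suc i"
    and T: "\<And>s i A. A \<in> \<A> \<Longrightarrow> f i (T s A) = f (t s i) A"
  obtains \<mu> where "\<And>A. 0 \<le> \<mu> A" "\<And>A. \<mu> A \<le> 1" "additive \<A> \<mu>" "\<mu> \<Omega> = (1::real)"
    "\<And>s A. A \<in> \<A> \<Longrightarrow> \<mu> (T s A) = \<mu> A"
proof -
  \<comment> \<open>\<open>C\<close> is a full cube, bounding \<mu> on all sets, so Tychonoff makes
    it compact; \<open>K N\<close> is an intersection of closed conditions on finitely many
    coordinates each.\<close>
  define C where "C = {\<mu> :: 'a set \<Rightarrow> real. \<forall>A. \<mu> A \<in> {0..1}}"
  define K where "K N = {\<mu> :: 'a set \<Rightarrow> real. additive \<A> \<mu> \<and> \<mu> \<Omega> = 1 \<and>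
    (\<forall>s. \<forall>A\<in>\<A>. \<bar>\<mu> (T s A) - \<mu> A\<bar> \<le> 1 / real (Suc N))}" for N
  define m where "m N A = (\<Sum>i<Suc N. f i A) / real (Suc N)" for N A
  have m: "m N \<in> C \<inter> K N" for N
  proof -
    have "0 \<le> m N A" "m N A \<le> 1" for A
      using f(1) sum_bounded_above[of "{..<Suc N}" "\<lambda>i. f i A" 1] f(2)
      by (auto simp: m_def sum_nonneg simp del: sum.lessThan_Suc)
    moreover have "additive \<A> (m N)"
      using f(3) by (auto simp: m_def additive_def sum.distrib add_divide_distrib simp del: sum.lessThan_Suc)
    moreover have "m N \<Omega> = 1"
      by (simp add: m_def f(4))
    moreover have "\<bar>m N (T s A) - m N A\<bar> \<le> 1 / real (Suc N)" if "A \<in> \<A>" for s A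
    proof -
      have "\<bar>(\<Sum>i<Suc N. f (t s i) A) - (\<Sum>i<Suc N. f i A)\<bar> \<le> 1"
        using f t by (intro abs_sum_inj_diff_le_1) auto
      then show ?thesis
        using that unfolding m_def diff_divide_distrib[symmetric] abs_divide
        by (simp add: T divide_right_mono del: sum.lessThan_Suc)
    qed
    ultimately show ?thesis
      by (simp add: C_def K_def)
  qed
  have "compactin (product_topology (\<lambda>_. euclidean) UNIV) (PiE UNIV (\<lambda>_ :: 'a set. {0..1::real}))"
    by (simp add: compactin_PiE)
  then have "compact C"
    by (simp add: C_def euclidean_product_topology PiE_UNIV_domain Pi_def)
  moreover have "closed (K N)" for N
  proof -
    note cont = continuous_on_product_coordinates
    have imp: "closed {\<mu> :: 'a set \<Rightarrow> real. P \<longrightarrow> Q \<mu>}" if "closed {\<mu>. Q \<mu>}" for P Q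
      using that by (cases P) auto
    show ?thesis
      unfolding K_def additive_def Ball_def
      by (intro imp closed_Collect_conj closed_Collect_all closed_Collect_eq closed_Collect_le
            continuous_intros cont) auto
  qed
  \<comment> \<open>The sets \<open>K N\<close> decrease, so the average \<open>m M\<close>, with
    \<open>M\<close> an upper bound of \<open>I\<close>, lies in all of them.\<close>
  moreover have "C \<inter> (\<Inter>N\<in>I. K N) \<noteq> {}" if "finite I" for I
  proof -
    obtain M where M: "\<And>N. N \<in> I \<Longrightarrow> N \<le> M"
      using \<open>finite I\<close> by (metis finite_nat_set_iff_bounded_le)
    have "K M \<subseteq> K N" if "N \<le> M" for N
    proof -
      have "1 / real (Suc M) \<le> 1 / real (Suc N)"
        using that by (simp add: frac_le)
      then show ?thesis
        unfolding K_def by (auto intro: order_trans)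
    qed
    then show ?thesis
      using m[of M] M by blast
  qed
  ultimately have "C \<inter> (\<Inter>N\<in>UNIV. K N) \<noteq> {}"
    by (rule compact_imp_fip_image)
  then obtain \<mu> where \<mu>: "\<mu> \<in> C" "\<And>N. \<mu> \<in> K N"
    by auto
  have "\<mu> (T s A) = \<mu> A" if "A \<in> \<A>" for s A
  proof (rule ccontr)
    assume "\<mu> (T s A) \<noteq> \<mu> A"
    then obtain N where "1 / real (Suc N) < \<bar>\<mu> (T s A) - \<mu> A\<bar>"
      using reals_Archimedean[of "\<bar>\<mu> (T s A) - \<mu> A\<bar>"] by (auto simp: inverse_eq_divide)
    moreover have "\<bar>\<mu> (T s A) - \<mu> A\<bar> \<le> 1 / real (Suc N)"
      using \<mu>(2)[of N] that unfolding K_def by blast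
    ultimately show False
      by linarith
  qed
  then show ?thesis
    using that[of \<mu>] \<mu> by (auto simp: C_def K_def)
qed

text \<open>Since \<open>0 - 1 = 0\<close> in \<open>nat\<close>, \<open>b\<close> fixes the
  endpoint 0.\<close>

definition ray :: "gen \<Rightarrow> nat \<Rightarrow> nat" where
  "ray s i = (case s of
     Gen_a \<Rightarrow> if even i then Suc i else i - 1
   | Gen_b \<Rightarrow> if odd i then Suc i else i - 1
   | Gen_c \<Rightarrow> i)"

interpretation ray: involutions ray
  by unfold_locales (auto simp: ray_def split: gen.split elim!: oddE evenE)

lemma ray_le_Suc: "ray s i \<le> Suc i"
  by (auto simp: ray_def split: gen.split)

lemma ex_ray_Suc: "\<exists>s. ray s i = Suc i"
  by (cases "even i") (auto simp: ray_def intro: exI[of _ Gen_a] exI[of _ Gen_b])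

section \<open>Products of countable spaces\<close>

lemma sets_PiM_pmf: "sets (PiM UNIV (\<lambda>n. measure_pmf (p n))) = sets (borel :: ('i::countable \<Rightarrow> nat) measure)"
proof -
  have "sets (PiM UNIV (\<lambda>n. measure_pmf (p n))) = sets (PiM UNIV (\<lambda>_ :: 'i. borel :: nat measure))"
    by (intro sets_PiM_cong) (simp_all add: sets_borel_eq_count_space)
  then show ?thesis
    by (simp add: sets_PiM_equal_borel)
qed

lemma continuous_on_coordinatewise_nat:
  fixes f :: "'i \<Rightarrow> nat \<Rightarrow> nat"
  shows "continuous_on UNIV (\<lambda>x n. f n (x n))"
proof (rule continuous_on_coordinatewise_then_product)
  fix n :: 'i
  have "continuous_on UNIV (\<lambda>x. x n :: nat)"
    by (rule continuous_on_product_coordinates)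
  then show "continuous_on UNIV (\<lambda>x. f n (x n))"
    by (rule continuous_on_compose2[of UNIV "f n", rotated]) auto
qed

text \<open>The measures agree on cylinders, whose preimages under a coordinatewise map are
  cylinders, and cylinders determine a finite measure.\<close>

lemma distr_PiM_pmf_coordinatewise:
  fixes f :: "'i::countable \<Rightarrow> nat \<Rightarrow> nat"
  shows "distr (PiM UNIV (\<lambda>n. measure_pmf (p n))) borel (\<lambda>x n. f n (x n)) =
    PiM UNIV (\<lambda>n. measure_pmf (map_pmf (f n) (p n)))" (is "distr ?P borel ?f = ?Q")
proof (rule measure_eqI_PiM_infinite[of _ UNIV "\<lambda>n. measure_pmf (map_pmf (f n) (p n))"])
  interpret P: prob_space ?P
    by (intro prob_space_PiM measure_pmf.prob_space_axioms)
  have f: "?f \<in> measurable ?P borel"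
    using borel_measurable_continuous_onI[OF continuous_on_coordinatewise_nat[of f]]
      measurable_cong_sets[OF sets_PiM_pmf[of p] refl, of borel] by blast
  then show "finite_measure (distr ?P borel ?f)"
    by (rule P.finite_measure_distr)
  show "sets (distr ?P borel ?f) = sets ?Q"
    by (simp only: sets_distr sets_PiM_pmf)
  fix A :: "'i \<Rightarrow> nat set" and J :: "'i set"
  assume J: "finite J"
  have "prod_emb UNIV (\<lambda>n. measure_pmf (map_pmf (f n) (p n))) J (PiE J A) \<in> sets ?Q"
    using J by (intro sets_PiM_I) auto
  then have meas: "prod_emb UNIV (\<lambda>n. measure_pmf (map_pmf (f n) (p n))) J (PiE J A) \<in> sets borel"
    by (simp only: sets_PiM_pmf)
  have "?f -` prod_emb UNIV (\<lambda>n. measure_pmf (map_pmf (f n) (p n))) J (PiE J A) \<inter> space ?P =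
    prod_emb UNIV (\<lambda>n. measure_pmf (p n)) J (PiE J (\<lambda>n. f n -` A n))"
    by (auto simp: prod_emb_def space_PiM PiE_iff restrict_def extensional_def)
  then show "emeasure (distr ?P borel ?f) (prod_emb UNIV (\<lambda>n. measure_pmf (map_pmf (f n) (p n))) J (PiE J A)) =
      emeasure ?Q (prod_emb UNIV (\<lambda>n. measure_pmf (map_pmf (f n) (p n))) J (PiE J A))"
    using J by (simp add: emeasure_distr[OF f meas] emeasure_PiM_emb measure_pmf.prob_space_axioms)
qed (rule refl)

lemma polish_topology_Baire: "polish_topology (euclidean :: (nat \<Rightarrow> nat) topology)"
proof -
  have "(euclidean :: nat topology) = discrete_topology UNIV"
    by (auto simp: topology_eq discrete_topology_class.open_discrete)
  then have "completely_metrizable_space (euclidean :: nat topology)"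
    by (simp add: completely_metrizable_space_discrete_topology)
  then have "completely_metrizable_space (product_topology (\<lambda>_ :: nat. euclidean :: nat topology) UNIV)"
    by (simp add: completely_metrizable_space_product_topology)
  moreover obtain S :: "(nat \<Rightarrow> nat) set"
    where S: "countable S" "\<And>U. open U \<Longrightarrow> U \<noteq> {} \<Longrightarrow> \<exists>x\<in>S. x \<in> U"
    using countable_dense_setE by blast
  have "closure S = UNIV"
    using S(2)[of "- closure S"] closure_subset[of S] by auto
  with S(1) have "separable_space (euclidean :: (nat \<Rightarrow> nat) topology)"
    by (auto simp: separable_space_def)
  ultimately show ?thesis
    by (simp add: polish_topology_def euclidean_product_topology)
qed

lemma borel_sets_euclidean: "borel_sets (euclidean :: 'a::topological_space topology) = sets borel"
  by (simp add: borel_sets_def borel_def open_openin[symmetric])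

section \<open>The example\<close>

text \<open>As the group is discrete, the preimage of an open set is a union of open slices.\<close>

lemma continuous_action_euclidean:
  fixes \<phi> :: "'g \<Rightarrow> 'a::topological_space \<Rightarrow> 'a"
  assumes "\<And>g. g \<in> carrier G \<Longrightarrow> continuous_on UNIV (\<phi> g)"
  shows "continuous_action G euclidean \<phi>"
  unfolding continuous_action_def continuous_map_def
proof (intro conjI allI impI)
  fix U :: "'a set"
  assume "openin euclidean U"
  have "openin (prod_topology (discrete_topology (carrier G)) euclidean) ({g} \<times> (\<phi> g -` U))"
    if "g \<in> carrier G" for g
    using that \<open>openin euclidean U\<close> assms[OF that]
    by (auto simp: openin_prod_Times_iff open_vimage)
  then have "openin (prod_topology (discrete_topology (carrier G)) euclidean)
      (\<Union>g\<in>carrier G. {g} \<times> (\<phi> g -` U))"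
    by blast
  moreover have "{x \<in> topspace (prod_topology (discrete_topology (carrier G)) euclidean).
      (case x of (g, x) \<Rightarrow> \<phi> g x) \<in> U} = (\<Union>g\<in>carrier G. {g} \<times> (\<phi> g -` U))"
    by auto
  ultimately show "openin (prod_topology (discrete_topology (carrier G)) euclidean)
      {x \<in> topspace (prod_topology (discrete_topology (carrier G)) euclidean).
        (case x of (g, x) \<Rightarrow> \<phi> g x) \<in> U}"
    by simp
qed auto

theorem theorem1p7:
  shows "\<exists>(X :: (nat \<Rightarrow> nat) topology) (\<phi> :: gen list set \<Rightarrow> (nat \<Rightarrow> nat) \<Rightarrow> (nat \<Rightarrow> nat)).
    polish_topology X \<and>
    group_action Z2_free3 (topspace X) \<phi> \<and>
    continuous_action Z2_free3 X \<phi> \<and>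
    free_action Z2_free3 (topspace X) \<phi> \<and>
    paradoxical_action Z2_free3 (topspace X) \<phi> \<and>
    (\<exists>\<mu>. finitely_additive_borel_prob X \<mu> \<and>
         invariant_set_function Z2_free3 \<phi> (borel_sets X) \<mu>) \<and>
    \<not> (\<exists>M. countably_additive_borel_prob X M \<and>
           invariant_set_function Z2_free3 \<phi> (borel_sets X) (emeasure M))"
proof -

  \<comment> \<open>The free action on the product\<close>
  obtain \<kappa> :: "nat \<Rightarrow> gen \<Rightarrow> nat \<Rightarrow> nat" and F :: "nat \<Rightarrow> nat set" where
    \<kappa>: "\<And>n. involutions (\<kappa> n)" and F: "\<And>n. finite (F n)" "\<And>n. F n \<noteq> {}" "\<And>n s. \<kappa> n s ` F n \<subseteq> F n" and
    \<kappa>_free: "\<And>n w i. distinct_adj w \<Longrightarrow> w \<noteq> [] \<Longrightarrow> length w \<le> n \<Longrightarrow> foldr (\<kappa> n) w i \<noteq> i"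
    using ex_finite_quotient by metis
  define \<rho> where "\<rho> n = (case n of 0 \<Rightarrow> ray | Suc m \<Rightarrow> \<kappa> m)" for n
  define \<sigma> where "\<sigma> s x = (\<lambda>n. \<rho> n s (x n))" for s and x :: "nat \<Rightarrow> nat"
  have \<rho>: "involutions (\<rho> n)" for n
    using \<kappa> ray.involutions_axioms by (simp add: \<rho>_def split: nat.split)
  have foldr_\<sigma>: "foldr \<sigma> w x n = foldr (\<rho> n) w (x n)" for w x n
    by (induction w) (simp_all add: \<sigma>_def)
  interpret free_involutions \<sigma>
  proof
    show "\<sigma> s (\<sigma> s x) = x" for s x
      using involutions.invol[OF \<rho>] by (simp add: \<sigma>_def)
    \<comment> \<open>Coordinate \<open>Suc (length w)\<close> carries a quotient in which words as
      long as \<open>w\<close> still act freely.\<close>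
    show "foldr \<sigma> w x \<noteq> x" if "distinct_adj w" "w \<noteq> []" for w x
      using \<kappa>_free[OF that order_refl, of "x (Suc (length w))"] foldr_\<sigma>[of w x "Suc (length w)"]
      by (auto simp: \<rho>_def)
  qed
  have cont_\<sigma>: "continuous_on UNIV (\<sigma> s)" for s
    unfolding \<sigma>_def by (rule continuous_on_coordinatewise_nat)
  have borel_\<sigma>: "\<sigma> s -` A \<in> sets borel" if "A \<in> sets borel" for s A
    using measurable_sets[OF borel_measurable_continuous_onI[OF cont_\<sigma>] that] by simp
  have cont: "continuous_on UNIV (foldr \<sigma> w)" for w
  proof (induction w)
    case (Cons s w)
    then show ?case
      using continuous_on_compose[of UNIV "foldr \<sigma> w" "\<sigma> s"] cont_\<sigma> continuous_on_subset by force
  qed (simp add: id_def continuous_on_id)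
  have inv_gen: "\<mu> (\<sigma> s -` A) = \<mu> A"
    if "invariant_set_function Z2_free3 act (sets borel) \<mu>" "A \<in> sets borel" for \<mu> :: "_ \<Rightarrow> 'b" and s A
  proof -
    have "word_class [s] \<in> carrier Z2_free3"
      by (simp add: Z2_free3_def)
    then have "\<mu> (act (word_class [s]) ` A) = \<mu> A"
      using that by (auto simp: invariant_set_function_def)
    then show ?thesis
      using image_invol[of s A] by (simp add: act_word_class)
  qed

  \<comment> \<open>The invariant mean\<close>
  define p where "p i n = (case n of 0 \<Rightarrow> return_pmf i | Suc m \<Rightarrow> pmf_of_set (F m))" for i n
  define \<nu> where "\<nu> i = PiM UNIV (\<lambda>n. measure_pmf (p i n))" for i
  have prob_\<nu>: "prob_space (\<nu> i)" for i
    unfolding \<nu>_def by (intro prob_space_PiM measure_pmf.prob_space_axioms)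
  have sets_\<nu>: "sets (\<nu> i) = sets borel" for i
    unfolding \<nu>_def by (rule sets_PiM_pmf)
  \<comment> \<open>At coordinate 0 the point mass moves along the ray; later, a bijection of
    \<open>F m\<close> preserves its uniform measure.\<close>
  have "map_pmf (\<rho> n s) (p i n) = p (ray s i) n" for n s i
  proof (cases n)
    case (Suc m)
    have inj: "inj_on (\<kappa> m s) (F m)"
      by (metis inj_onI involutions.invol \<kappa>)
    then have "\<kappa> m s ` F m = F m"
      using F by (intro endo_inj_surj) auto
    then show ?thesis
      using F inj by (simp add: Suc \<rho>_def p_def map_pmf_of_set_inj)
  qed (simp add: \<rho>_def p_def)
  then have distr_\<nu>: "distr (\<nu> i) borel (\<sigma> s) = \<nu> (ray s i)" for i s
    using distr_PiM_pmf_coordinatewise[of "p i" "\<lambda>n. \<rho> n s" for i s]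
    unfolding \<nu>_def \<sigma>_def by (simp only:)
  have \<nu>_inv: "measure (\<nu> i) (\<sigma> s -` A) = measure (\<nu> (ray s i)) A" if "A \<in> sets borel" for i s A
  proof -
    have "\<sigma> s \<in> measurable (\<nu> i) borel"
      using borel_measurable_continuous_onI[OF cont_\<sigma>] measurable_cong_sets[OF sets_\<nu> refl] by blast
    then show ?thesis
      using that sets_eq_imp_space_eq[OF sets_\<nu>, of i]
      by (simp add: distr_\<nu>[symmetric] measure_distr)
  qed
  have "additive (sets borel) (measure (\<nu> i))" for i
    using finite_measure.finite_measure_Union[OF prob_space.finite_measure[OF prob_\<nu>[of i]]]
    by (simp add: additive_def sets_\<nu>)
  moreover have "measure (\<nu> i) UNIV = 1" for i
    using prob_space.prob_space[OF prob_\<nu>[of i]] sets_eq_imp_space_eq[OF sets_\<nu>, of i] by simp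
  ultimately obtain \<mu> where \<mu>: "\<And>A. 0 \<le> \<mu> A" "\<And>A. \<mu> A \<le> 1" "additive (sets borel) \<mu>" "\<mu> UNIV = (1::real)"
    "\<And>s A. A \<in> sets borel \<Longrightarrow> \<mu> (\<sigma> s -` A) = \<mu> A"
    using ex_invariant_mean[of "\<lambda>i. measure (\<nu> i)" "sets borel" UNIV ray "\<lambda>s A. \<sigma> s -` A"]
      prob_space.prob_le_1[OF prob_\<nu>] ray_le_Suc \<nu>_inv by (auto simp: measure_nonneg)
  \<comment> \<open>Borel membership is carried through the induction because invariance under a
    generator is known for Borel sets only.\<close>
  have \<mu>_inv: "foldr \<sigma> w ` A \<in> sets borel \<and> \<mu> (foldr \<sigma> w ` A) = \<mu> A" if "A \<in> sets borel" for w A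
  proof (induction w)
    case (Cons s w)
    have "foldr \<sigma> (s # w) ` A = \<sigma> s -` (foldr \<sigma> w ` A)"
      unfolding image_invol[symmetric] by (simp add: image_comp)
    then show ?case
      using Cons \<mu>(5) borel_\<sigma> by simp
  qed (use that in simp)

  \<comment> \<open>Nonexistence of a countably additive invariant measure\<close>
  have False if M: "countably_additive_borel_prob euclidean M"
    "invariant_set_function Z2_free3 act (sets borel) (emeasure M)" for M
  proof -
    interpret prob_space M
      using M(1) by (simp add: countably_additive_borel_prob_def)
    have M_sets: "sets M = sets borel" "space M = UNIV"
      using M(1) by (simp_all add: countably_additive_borel_prob_def borel_sets_euclidean)
    define A where "A i = {x :: nat \<Rightarrow> nat. x 0 = i}" for i
    have A: "A i \<in> sets borel" for i
    proof -
      have "open ((\<lambda>x :: nat \<Rightarrow> nat. x 0) -` {i})"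
        by (intro open_vimage discrete_topology_class.open_discrete continuous_on_product_coordinates)
      then show ?thesis
        by (auto simp: A_def vimage_def)
    qed
    \<comment> \<open>Some generator swaps \<open>i\<close> and \<open>Suc i\<close> on the ray,
      hence the fibres over them.\<close>
    have "emeasure M (A (Suc i)) = emeasure M (A i)" for i
    proof -
      obtain s where s: "ray s i = Suc i"
        using ex_ray_Suc by blast
      then have "ray s (Suc i) = i"
        by (metis ray.invol)
      then have "\<sigma> s -` A i = A (Suc i)"
        using s by (auto simp: A_def \<sigma>_def \<rho>_def)
      then show ?thesis
        using inv_gen[OF M(2) A, of s i] by simp
    qed
    then have "measure M (A i) = measure M (A 0)" for i
      by (induction i) (simp_all add: measure_def)
    then have "(\<lambda>i. measure M (A i)) = (\<lambda>i. measure M (A 0))"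
      by blast
    moreover have "(\<lambda>i. measure M (A i)) sums measure M (\<Union>i. A i)"
      using A by (intro finite_measure_UNION) (auto simp: M_sets disjoint_family_on_def A_def)
    moreover have "(\<Union>i. A i) = space M"
      by (auto simp: A_def M_sets)
    \<comment> \<open>A constant series converges only if the constant is 0, and then its sum is not
      1.\<close>
    ultimately have "(\<lambda>i::nat. measure M (A 0)) sums 1"
      by (simp add: prob_space)
    then show False
      using summable_const_iff[of "measure M (A 0)"] by (auto simp: sums_iff)
  qed
  moreover have "continuous_action Z2_free3 euclidean act"
    using cont by (intro continuous_action_euclidean) (auto simp: Z2_free3_def act_word_class)
  moreover have "finitely_additive_borel_prob euclidean \<mu>"
    using \<mu> by (simp add: finitely_additive_borel_prob_def borel_sets_euclidean)
  moreover have "invariant_set_function Z2_free3 act (sets borel) \<mu>"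
    using \<mu>_inv by (auto simp: invariant_set_function_def Z2_free3_def act_word_class)
  ultimately show ?thesis
    using polish_topology_Baire group_action_act free_action_act paradoxical_action_act
    by (intro exI[of _ euclidean] exI[of _ act]) (auto simp: borel_sets_euclidean)
qed

end
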